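(* Let $F:\mathbb{R}^d\to\mathbb{R}^d$ be $\rho$-comonotone with $\rho>-1$, i.e. $$\langle F(z_a)-F(z_b),z_a-z_b\rangle\ \ge\ \rho\,\|F(z_a)-F(z_b)\|^2\qquad\text{for all } z_a,z_b\in\mathbb{R}^d,$$ and suppose $F$ has at least one zero. Let $z_0\in\mathbb{R}^d$ and let $(s,v,z)$ be a solution on $[0,\infty)$, with $s(0)=0$, of the system $$\dot s(t)=-F(z(t)),\qquad v(t)=z_0+s(t),\qquad z(t)-v(t)+F(z(t))=0 .$$ Then $t\mapsto\|F(z(t))\|$ is non-increasing on $[0,\infty)$, and $\|F(z(t))\|^2=O(1/t)$, i.e. there is a constant $C$ independent of $t$ with $\|F(z(t))\|^2\le C/t$ for all $t>0$.
   Context: $\|\cdot\|$ and $\langle\cdot,\cdot\rangle$ are the Euclidean norm and inner product on $\mathbb{R}^d$. The paper assumes throughout that the solution set $\mathcal{Z}^*$ of the Stampacchia variational inequality $\langle F(z^* ),z-z^*\rangle\ge 0$ for all $z$ is nonempty; in the unconstrained setting $\mathcal{Z}=\mathbb{R}^d$ this means that $F$ has a zero. A solution of the system means functions $s,v,z:[0,\infty)\to\mathbb{R}^d$ with $s$ continuously differentiable and $z$ continuous, satisfying the three relations for all $t\ge 0$. *)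

theory Defs
  imports "HOL-Analysis.Analysis"
begin

definition comonotone :: "real \<Rightarrow> ('a::real_inner \<Rightarrow> 'a) \<Rightarrow> bool" where
  "comonotone \<rho> F \<longleftrightarrow>
     (\<forall>za zb. (F za - F zb) \<bullet> (za - zb) \<ge> \<rho> * (norm (F za - F zb))\<^sup>2)"

text \<open>
  The functions are total on the reals, but only their values on \<open>{0..}\<close> are constrained; at
  \<open>t = 0\<close> the derivative of \<open>s\<close> is the one-sided one. The witness \<open>s'\<close> is the derivative of \<open>s\<close>,
  whose continuity is the requirement that \<open>s\<close> be continuously differentiable.
\<close>
definition is_solution ::
  "('a::real_inner \<Rightarrow> 'a) \<Rightarrow> 'a \<Rightarrow> (real \<Rightarrow> 'a) \<Rightarrow> (real \<Rightarrow> 'a) \<Rightarrow> (real \<Rightarrow> 'a) \<Rightarrow> bool" where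
  "is_solution F z0 s v z \<longleftrightarrow>
     (\<exists>s'. continuous_on {0..} s' \<and>
        (\<forall>t\<ge>0. (s has_vector_derivative s' t) (at t within {0..}) \<and> s' t = - F (z t))) \<and>
     continuous_on {0..} z \<and>
     (\<forall>t\<ge>0. v t = z0 + s t) \<and>
     (\<forall>t\<ge>0. z t - v t + F (z t) = 0)"

end

theory Submission
  imports Defs
begin

text \<open>
  Along a solution, \<open>v = z + F z\<close>, so comonotonicity of \<open>F\<close> says that \<open>u = F \<circ> z\<close>, as a function
  of \<open>v\<close>, is cocoercive with constant \<open>c = 1 + \<rho> > 0\<close>, while \<open>v' = -u\<close>. Hence the distance
  between \<open>v\<close> and its time shift by \<open>h\<close> is non-increasing; dividing by \<open>h\<close> and letting \<open>h\<close> tend to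
  \<open>0\<close> shows that \<open>\<parallel>u\<parallel>\<close> is non-increasing. For a zero \<open>z*\<close> of \<open>F\<close>, the derivative of
  \<open>\<parallel>v - z*\<parallel>\<^sup>2\<close> is at most \<open>-2 c \<parallel>u\<parallel>\<^sup>2\<close>, which by monotonicity gives
  \<open>2 c t \<parallel>u t\<parallel>\<^sup>2 \<le> \<parallel>z0 - z*\<parallel>\<^sup>2\<close>.
\<close>

lemma has_real_derivative_norm_square:
  fixes f :: "real \<Rightarrow> 'a::real_inner"
  assumes "(f has_vector_derivative f') (at t within S)"
  shows "((\<lambda>t. (norm (f t))\<^sup>2) has_real_derivative 2 * (f t \<bullet> f')) (at t within S)"
proof -
  have "((\<lambda>t. f t \<bullet> f t) has_derivative (\<lambda>h. f t \<bullet> (h *\<^sub>R f') + (h *\<^sub>R f') \<bullet> f t)) (at t within S)"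
    using assms unfolding has_vector_derivative_def by (intro has_derivative_inner)
  moreover have "(\<lambda>h. f t \<bullet> (h *\<^sub>R f') + (h *\<^sub>R f') \<bullet> f t) = (*) (2 * (f t \<bullet> f'))"
    by (auto simp: inner_commute)
  ultimately show ?thesis
    by (simp add: has_field_derivative_def power2_norm_eq_inner)
qed

lemma has_vector_derivative_tendsto_slope:
  fixes f :: "real \<Rightarrow> 'a::real_normed_vector"
  assumes "(f has_vector_derivative D) (at_right a)"
  shows "((\<lambda>h. (f (a + h) - f a) /\<^sub>R h) \<longlongrightarrow> D) (at_right 0)"
proof -
  have "((\<lambda>y. (1 / norm (y - a)) *\<^sub>R (f y - (f a + (y - a) *\<^sub>R D))) \<longlongrightarrow> 0) (at_right a)"
    using assms unfolding has_vector_derivative_def has_derivative_within by blast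
  then have "((\<lambda>h. (1 / \<bar>h\<bar>) *\<^sub>R (f (h + a) - (f a + h *\<^sub>R D))) \<longlongrightarrow> 0) (at_right 0)"
    by (simp add: filterlim_at_right_to_0[of _ _ a])
  moreover have "\<forall>\<^sub>F h in at_right 0. (1 / \<bar>h\<bar>) *\<^sub>R (f (h + a) - (f a + h *\<^sub>R D))
      = (f (a + h) - f a) /\<^sub>R h - D"
    unfolding eventually_at_right_field
    by (intro exI[of _ 1]) (auto simp: algebra_simps divide_inverse)
  ultimately have "((\<lambda>h. (f (a + h) - f a) /\<^sub>R h - D) \<longlongrightarrow> 0) (at_right 0)"
    using tendsto_cong by fast
  then show ?thesis
    by (simp add: LIM_zero_iff)
qed

text \<open>Only the trajectory is kept: cocoercivity relates values of \<open>u\<close> and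
  \<open>v\<close> at two times, so neither \<open>F\<close> nor \<open>u\<close> as a function of
  \<open>v\<close> has to appear.\<close>

locale cocoercive_flow =
  fixes u v :: "real \<Rightarrow> 'a::real_inner" and c :: real
  assumes c_nonneg: "c \<ge> 0"
    and deriv: "t \<ge> 0 \<Longrightarrow> (v has_vector_derivative - u t) (at t within {0..})"
    and cocoercive: "\<lbrakk>a \<ge> 0; b \<ge> 0\<rbrakk> \<Longrightarrow> (u a - u b) \<bullet> (v a - v b) \<ge> c * (norm (u a - u b))\<^sup>2"
begin

lemma deriv_at:
  assumes "t > 0"
  shows "(v has_vector_derivative - u t) (at t)"
  using deriv[of t] assms at_within_interior[of t "{0::real..}"] by (simp add: interior_real_atLeast)

lemma continuous_on_v: "continuous_on {0..} v"
  by (auto simp: continuous_on_eq_continuous_within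
      intro: has_vector_derivative_continuous deriv)

text \<open>The squared distance has derivative \<open>-2\<close> times an inner product that
  \<open>cocoercive\<close> makes nonnegative. As \<open>u\<close> is not assumed differentiable,
  shifts of \<open>v\<close> replace differentiating its norm.\<close>

lemma norm_shift_antimono:
  assumes "0 \<le> a" "a \<le> b" "h \<ge> 0"
  shows "norm (v (b + h) - v b) \<le> norm (v (a + h) - v a)"
proof -
  let ?g = "\<lambda>t. (norm (v (t + h) - v t))\<^sup>2"
  have "?g a \<ge> ?g b"
  \<comment> \<open>Derivatives are needed at interior times only, which are positive, so two-sided
    ones exist; continuity covers a left end \<open>a = 0\<close>.\<close>
  proof (rule DERIV_nonpos_imp_decreasing_open[OF \<open>a \<le> b\<close>])
    fix t assume "a < t" "t < b"
    then have t: "t > 0" "t + h > 0" using assms by auto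
    have "((\<lambda>t. t + h) has_vector_derivative 1) (at t)"
      using has_vector_derivative_add[OF has_vector_derivative_id has_vector_derivative_const]
      by simp
    then have "((\<lambda>t. v (t + h)) has_vector_derivative - u (t + h)) (at t)"
      using vector_diff_chain_at[of "\<lambda>t. t + h" 1 t v, OF _ deriv_at[OF t(2)]]
      by (simp add: o_def)
    from has_vector_derivative_diff[OF this deriv_at[OF t(1)]]
    have "((\<lambda>t. v (t + h) - v t) has_vector_derivative - (u (t + h) - u t)) (at t)"
      by (simp only: minus_diff_minus)
    from has_real_derivative_norm_square[OF this]
    have "(?g has_real_derivative 2 * ((v (t + h) - v t) \<bullet> - (u (t + h) - u t))) (at t)" .
    moreover have "(u (t + h) - u t) \<bullet> (v (t + h) - v t) \<ge> 0"
      using t c_nonneg by (intro order_trans[OF _ cocoercive]) auto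
    ultimately show "\<exists>y. (?g has_real_derivative y) (at t) \<and> y \<le> 0"
      by (intro exI conjI) (auto simp: inner_commute inner_diff_left)
  next
    show "continuous_on {a..b} ?g"
      using assms
      by (intro continuous_intros continuous_on_compose2[OF continuous_on_v]) auto
  qed
  then show ?thesis by (rule power2_le_imp_le) simp
qed

text \<open>The limit is taken from the right so as to include \<open>a = 0\<close>, where only a
  one-sided derivative is given.\<close>

lemma tendsto_norm_slope:
  assumes "a \<ge> 0"
  shows "((\<lambda>h. norm (v (a + h) - v a) / h) \<longlongrightarrow> norm (u a)) (at_right 0)"
proof -
  have "(v has_vector_derivative - u a) (at_right a)"
    by (rule has_vector_derivative_within_subset[OF deriv[OF assms]]) (use assms in auto)
  from tendsto_norm[OF has_vector_derivative_tendsto_slope[OF this]]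
  have "((\<lambda>h. norm ((v (a + h) - v a) /\<^sub>R h)) \<longlongrightarrow> norm (u a)) (at_right 0)"
    by simp
  moreover have "\<forall>\<^sub>F h in at_right (0::real).
      norm ((v (a + h) - v a) /\<^sub>R h) = norm (v (a + h) - v a) / h"
    unfolding eventually_at_right_field by (intro exI[of _ 1]) (auto simp: divide_inverse_commute)
  ultimately show ?thesis
    using tendsto_cong by fast
qed

lemma norm_velocity_antimono:
  assumes "0 \<le> a" "a \<le> b"
  shows "norm (u b) \<le> norm (u a)"
proof (rule tendsto_le)
  show "((\<lambda>h. norm (v (a + h) - v a) / h) \<longlongrightarrow> norm (u a)) (at_right 0)"
    and "((\<lambda>h. norm (v (b + h) - v b) / h) \<longlongrightarrow> norm (u b)) (at_right 0)"
    using assms by (auto intro: tendsto_norm_slope)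
  show "\<forall>\<^sub>F h in at_right 0. norm (v (b + h) - v b) / h \<le> norm (v (a + h) - v a) / h"
    unfolding eventually_at_right_field
    using norm_shift_antimono[OF assms] by (intro exI[of _ 1]) (auto intro!: divide_right_mono)
qed simp

lemma norm_velocity_bound:
  assumes "t \<ge> 0"
    and equilibrium: "\<And>r. r \<ge> 0 \<Longrightarrow> u r \<bullet> (v r - w) \<ge> c * (norm (u r))\<^sup>2"
  shows "2 * c * t * (norm (u t))\<^sup>2 \<le> (norm (v 0 - w))\<^sup>2"
proof -
  let ?g = "\<lambda>r. (norm (v r - w))\<^sup>2 + 2 * c * (norm (u t))\<^sup>2 * r"
  have "?g 0 \<ge> ?g t"
  proof (rule DERIV_nonpos_imp_decreasing_open[OF \<open>t \<ge> 0\<close>])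
    fix r assume r: "0 < r" "r < t"
    have "((\<lambda>r. v r - w) has_vector_derivative - u r) (at r)"
      using has_vector_derivative_diff[OF deriv_at[OF r(1)] has_vector_derivative_const] by simp
    from DERIV_add[OF has_real_derivative_norm_square[OF this] DERIV_cmult_Id]
    have "(?g has_real_derivative 2 * ((v r - w) \<bullet> - u r) + 2 * c * (norm (u t))\<^sup>2) (at r)" .
    moreover have "c * (norm (u t))\<^sup>2 \<le> c * (norm (u r))\<^sup>2"
      using norm_velocity_antimono[of r t] r c_nonneg
      by (intro mult_left_mono power_mono) auto
    then have "2 * ((v r - w) \<bullet> - u r) + 2 * c * (norm (u t))\<^sup>2 \<le> 0"
      using equilibrium[of r] r by (simp add: inner_commute)
    ultimately show "\<exists>y. (?g has_real_derivative y) (at r) \<and> y \<le> 0"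
      by blast
  next
    show "continuous_on {0..t} ?g"
      by (intro continuous_intros continuous_on_subset[OF continuous_on_v]) auto
  qed
  then have "2 * c * (norm (u t))\<^sup>2 * t \<le> (norm (v 0 - w))\<^sup>2"
    using zero_le_power2[of "norm (v t - w)"] by linarith
  then show ?thesis
    by (simp add: mult_ac)
qed

end

text \<open>The added \<open>F x - F y\<close> in the second factor contributes its own squared
  norm: this is the \<open>1\<close> that offsets a negative \<open>\<rho>\<close>.\<close>

lemma comonotone_resolvent_cocoercive:
  assumes "comonotone \<rho> F"
  shows "(F x - F y) \<bullet> ((x + F x) - (y + F y)) \<ge> (1 + \<rho>) * (norm (F x - F y))\<^sup>2"
proof -
  have "(x + F x) - (y + F y) = (x - y) + (F x - F y)"
    by simp
  then have "(F x - F y) \<bullet> ((x + F x) - (y + F y)) =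
      (F x - F y) \<bullet> (x - y) + (norm (F x - F y))\<^sup>2"
    by (simp only: inner_add_right power2_norm_eq_inner)
  then show ?thesis
    using assms by (simp add: comonotone_def distrib_right)
qed

theorem corollary3p2:
  fixes F :: "real ^ 'd \<Rightarrow> real ^ 'd"
    and \<rho> :: real
    and z0 :: "real ^ 'd"
    and s v z :: "real \<Rightarrow> real ^ 'd"
  assumes "\<rho> > -1"
    and "comonotone \<rho> F"
    and "\<exists>zs. F zs = 0"
    and "is_solution F z0 s v z"
    and "s 0 = 0"
  shows "antimono_on {0..} (\<lambda>t. norm (F (z t)))
    \<and> (\<exists>C. \<forall>t>0. (norm (F (z t)))\<^sup>2 \<le> C / t)"
proof -
  have s: "(s has_vector_derivative - F (z t)) (at t within {0..})"
    and v: "v t = z0 + s t" and vz: "v t = z t + F (z t)" if "t \<ge> 0" for t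
    using assms(4) that unfolding is_solution_def by (auto simp: algebra_simps)
  interpret cocoercive_flow "\<lambda>t. F (z t)" v "1 + \<rho>"
  proof
    fix t :: real assume "t \<ge> 0"
    then have "((\<lambda>t. z0 + s t) has_vector_derivative - F (z t)) (at t within {0..})"
      using has_vector_derivative_add[OF has_vector_derivative_const s] by simp
    \<comment> \<open>\<open>v\<close> is known to equal \<open>z0 + s\<close> only on
      \<open>{0..}\<close>, so the derivative is transferred within that set.\<close>
    then show "(v has_vector_derivative - F (z t)) (at t within {0..})"
      by (rule has_vector_derivative_transform[rotated 2]) (use v \<open>t \<ge> 0\<close> in auto)
  next
    fix a b :: real assume "a \<ge> 0" "b \<ge> 0"
    then show "(1 + \<rho>) * (norm (F (z a) - F (z b)))\<^sup>2 \<le> (F (z a) - F (z b)) \<bullet> (v a - v b)"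
      using comonotone_resolvent_cocoercive[OF assms(2)] by (simp add: vz)
  qed (use assms(1) in simp)
  obtain w where w: "F w = 0"
    using assms(3) by blast
  \<comment> \<open>The witness for \<open>C\<close> does not depend on \<open>t\<close>; since
    \<open>s 0 = 0\<close>, its \<open>v 0\<close> is \<open>z0\<close>.\<close>
  have "(norm (F (z t)))\<^sup>2 \<le> (norm (v 0 - w))\<^sup>2 / (2 * (1 + \<rho>)) / t" if "t > 0" for t
  proof -
    have "2 * (1 + \<rho>) * t * (norm (F (z t)))\<^sup>2 \<le> (norm (v 0 - w))\<^sup>2"
    proof (rule norm_velocity_bound)
      fix r :: real assume "r \<ge> 0"
      \<comment> \<open>As \<open>F w = 0\<close>, also \<open>w + F w = w\<close>, so cocoercivity
        against \<open>w\<close> is exactly this inequality.\<close>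
      then show "(1 + \<rho>) * (norm (F (z r)))\<^sup>2 \<le> F (z r) \<bullet> (v r - w)"
        using comonotone_resolvent_cocoercive[OF assms(2), where x = "z r" and y = w]
        by (simp add: vz w)
    qed (use that in simp)
    moreover have "2 * (1 + \<rho>) * t > 0"
      using that assms(1) by simp
    ultimately show ?thesis
      by (simp add: pos_le_divide_eq mult.commute)
  qed
  moreover have "antimono_on {0..} (\<lambda>t. norm (F (z t)))"
    by (auto intro!: monotone_onI norm_velocity_antimono)
  ultimately show ?thesis
    by blast
qed

end
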